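(* Let $B, C, D_1, D_2$ be groups with $C \leq B$, and let $G_1 = (D_1 \times C) \ast_C B$ and $G_2 = (D_2 \times C) \ast_C B$ be the amalgamated products in which $C$ is identified with the factor $\{1\}\times C$ of $D_i\times C$ and with the subgroup $C\leq B$. Suppose that $C$ is a retract of $B$, and that $D_1$ and $D_2$ have a common subgroup $H$ of the same finite index $n$. Then $G_1$ and $G_2$ have a common subgroup of index $n$.
   Context: All groups are assumed to be finitely generated. A subgroup $C\leq B$ is a retract of $B$ if there is a homomorphism $r:B\to C$ with $r|_C=\mathrm{id}_C$. Two groups $X, Y$ "have a common subgroup of (the same) index $n$" if there is a group $H$ that is isomorphic to a subgroup of index $n$ in $X$ and to a subgroup of index $n$ in $Y$. *)

theory Defs
  imports "HOL-Algebra.Generated_Groups"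
begin

section \<open>Finite generation, retracts, common subgroups of a given index\<close>

definition finitely_generated :: "('a, 'm) monoid_scheme \<Rightarrow> bool" where
  "finitely_generated G \<longleftrightarrow> (\<exists>S. finite S \<and> S \<subseteq> carrier G \<and> generate G S = carrier G)"

definition group_retract :: "'b set \<Rightarrow> ('b, 'm) monoid_scheme \<Rightarrow> bool" where
  "group_retract C B \<longleftrightarrow>
     subgroup C B \<and> (\<exists>r \<in> hom B (B\<lparr>carrier := C\<rparr>). \<forall>c \<in> C. r c = c)"

text \<open>The finiteness condition is needed because \<^const>\<open>card\<close> of an infinite set is 0;
  since there is always at least one coset, the index \<open>n\<close> is then positive.\<close>

definition has_index :: "('a, 'm) monoid_scheme \<Rightarrow> 'a set \<Rightarrow> nat \<Rightarrow> bool" where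
  "has_index G K n \<longleftrightarrow>
     subgroup K G \<and> finite (rcosets\<^bsub>G\<^esub> K) \<and> card (rcosets\<^bsub>G\<^esub> K) = n"

definition iso_to_subgroup_of_index ::
    "('h, 'k) monoid_scheme \<Rightarrow> ('a, 'm) monoid_scheme \<Rightarrow> nat \<Rightarrow> bool" where
  "iso_to_subgroup_of_index H X n \<longleftrightarrow> (\<exists>K. has_index X K n \<and> H \<cong> X\<lparr>carrier := K\<rparr>)"

text \<open>Finite generation of \<open>H\<close> is part of the definition because all groups under
  consideration are finitely generated.\<close>

definition common_subgroup_of_index ::
    "('h, 'k) monoid_scheme \<Rightarrow> ('a, 'm) monoid_scheme \<Rightarrow> ('b, 'n) monoid_scheme \<Rightarrow> nat \<Rightarrow> bool"
where
  "common_subgroup_of_index H X Y n \<longleftrightarrow>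
     group H \<and> finitely_generated H \<and>
     iso_to_subgroup_of_index H X n \<and> iso_to_subgroup_of_index H Y n"

text \<open>HOL cannot quantify existentially over the type of \<open>H\<close>. This loses nothing: \<open>H\<close> may be
  replaced by its isomorphic copy inside \<open>X\<close>; see \<open>have_common_subgroup_of_indexI\<close> below.\<close>

definition have_common_subgroup_of_index ::
    "('a, 'm) monoid_scheme \<Rightarrow> ('b, 'n) monoid_scheme \<Rightarrow> nat \<Rightarrow> bool" where
  "have_common_subgroup_of_index X Y n \<longleftrightarrow>
     (\<exists>H :: 'a monoid. common_subgroup_of_index H X Y n)"

lemma finitely_generated_iso:
  assumes "group G" "group H" "G \<cong> H" "finitely_generated G"
  shows "finitely_generated H"
proof -
  obtain f where f: "f \<in> iso G H"
    using assms(3) by (auto simp: is_iso_def)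
  obtain S where S: "finite S" "S \<subseteq> carrier G" "generate G S = carrier G"
    using assms(4) by (auto simp: finitely_generated_def)
  interpret group_hom G H f
    using assms f by (simp add: group_hom_def group_hom_axioms_def iso_def)
  have "generate H (f ` S) = f ` carrier G"
    using generate_img[OF S(2)] S(3) by simp
  also have "\<dots> = carrier H"
    using f by (simp add: iso_def bij_betw_def)
  finally show ?thesis
    unfolding finitely_generated_def using S
    by (intro exI[of _ "f ` S"]) (auto intro: hom_closed)
qed

lemma have_common_subgroup_of_indexI:
  fixes X :: "('a, 'm) monoid_scheme" and H :: "('h, 'k) monoid_scheme"
  assumes "group X" and H: "common_subgroup_of_index H X Y n"
  shows "have_common_subgroup_of_index X Y n"
proof -
  obtain K where K: "has_index X K n" "H \<cong> X\<lparr>carrier := K\<rparr>"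
    using H by (auto simp: common_subgroup_of_index_def iso_to_subgroup_of_index_def)
  define K' :: "'a monoid" where "K' = \<lparr>carrier = K, mult = mult X, one = one X\<rparr>"
  have *: "group H" "finitely_generated H" "iso_to_subgroup_of_index H Y n"
    using H by (auto simp: common_subgroup_of_index_def)
  have gK: "group (X\<lparr>carrier := K\<rparr>)"
    using K(1) \<open>group X\<close> by (auto simp: has_index_def intro: subgroup.subgroup_is_group)
  interpret K: group "X\<lparr>carrier := K\<rparr>" by fact
  have "group K'"
    using K.m_closed K.m_assoc K.one_closed K.l_one K.l_inv_ex
    by (intro groupI) (simp_all add: K'_def)
  have "iso H K' = iso H (X\<lparr>carrier := K\<rparr>)"
    unfolding iso_def hom_def K'_def by simp
  then have HK': "H \<cong> K'"
    using K(2) unfolding is_iso_def by simp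
  have K'H: "K' \<cong> H"
    using HK' *(1) group.iso_sym by blast
  have "K' \<cong> X\<lparr>carrier := K\<rparr>"
    using K'H K(2) iso_trans by blast
  moreover obtain L where L: "has_index Y L n" "H \<cong> Y\<lparr>carrier := L\<rparr>"
    using *(3) by (auto simp: iso_to_subgroup_of_index_def)
  moreover have "K' \<cong> Y\<lparr>carrier := L\<rparr>"
    using K'H L(2) iso_trans by blast
  moreover have "finitely_generated K'"
    using finitely_generated_iso[OF *(1) \<open>group K'\<close> HK' *(2)] .
  ultimately show ?thesis
    using \<open>group K'\<close> K(1)
    unfolding have_common_subgroup_of_index_def common_subgroup_of_index_def
      iso_to_subgroup_of_index_def by blast
qed


section \<open>Amalgamated products\<close>

text \<open>For homomorphisms \<open>i : C \<rightarrow> A\<close> and \<open>j : C \<rightarrow> B\<close> (both injective in the case of an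
  amalgamated product), the group \<open>A *\<^sub>C B\<close> consists of the words over the disjoint union of
  \<open>A\<close> and \<open>B\<close>, modulo the congruence generated by the multiplication tables of \<open>A\<close> and \<open>B\<close>
  and by \<open>i c = j c\<close> for \<open>c \<in> C\<close>. Inverses need no formal letters, since
  each letter already has an inverse letter in its own factor.\<close>

definition amalg_words ::
    "('a, 'm) monoid_scheme \<Rightarrow> ('b, 'n) monoid_scheme \<Rightarrow> ('a + 'b) list set" where
  "amalg_words A B = lists (carrier A <+> carrier B)"

inductive amalg_eq ::
    "('a, 'm) monoid_scheme \<Rightarrow> ('b, 'n) monoid_scheme \<Rightarrow> ('c, 'k) monoid_scheme \<Rightarrow>
     ('c \<Rightarrow> 'a) \<Rightarrow> ('c \<Rightarrow> 'b) \<Rightarrow> ('a + 'b) list \<Rightarrow> ('a + 'b) list \<Rightarrow> bool"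
  for A B C i j
where
  refl: "w \<in> amalg_words A B \<Longrightarrow> amalg_eq A B C i j w w"
| sym: "amalg_eq A B C i j u v \<Longrightarrow> amalg_eq A B C i j v u"
| trans: "amalg_eq A B C i j u v \<Longrightarrow> amalg_eq A B C i j v w \<Longrightarrow> amalg_eq A B C i j u w"
| append: "amalg_eq A B C i j u u' \<Longrightarrow> amalg_eq A B C i j v v' \<Longrightarrow>
     amalg_eq A B C i j (u @ v) (u' @ v')"
| one_left: "amalg_eq A B C i j [Inl \<one>\<^bsub>A\<^esub>] []"
| one_right: "amalg_eq A B C i j [Inr \<one>\<^bsub>B\<^esub>] []"
| mult_left: "x \<in> carrier A \<Longrightarrow> y \<in> carrier A \<Longrightarrow>
     amalg_eq A B C i j [Inl x, Inl y] [Inl (x \<otimes>\<^bsub>A\<^esub> y)]"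
| mult_right: "x \<in> carrier B \<Longrightarrow> y \<in> carrier B \<Longrightarrow>
     amalg_eq A B C i j [Inr x, Inr y] [Inr (x \<otimes>\<^bsub>B\<^esub> y)]"
| glue: "c \<in> carrier C \<Longrightarrow> amalg_eq A B C i j [Inl (i c)] [Inr (j c)]"

definition amalg_class ::
    "('a, 'm) monoid_scheme \<Rightarrow> ('b, 'n) monoid_scheme \<Rightarrow> ('c, 'k) monoid_scheme \<Rightarrow>
     ('c \<Rightarrow> 'a) \<Rightarrow> ('c \<Rightarrow> 'b) \<Rightarrow> ('a + 'b) list \<Rightarrow> ('a + 'b) list set" where
  "amalg_class A B C i j w = {v. amalg_eq A B C i j w v}"

definition amalgamated_product ::
    "('a, 'm) monoid_scheme \<Rightarrow> ('b, 'n) monoid_scheme \<Rightarrow> ('c, 'k) monoid_scheme \<Rightarrow>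
     ('c \<Rightarrow> 'a) \<Rightarrow> ('c \<Rightarrow> 'b) \<Rightarrow> ('a + 'b) list set monoid" where
  "amalgamated_product A B C i j =
     \<lparr>carrier = amalg_class A B C i j ` amalg_words A B,
      mult = (\<lambda>X Y. \<Union>u\<in>X. \<Union>v\<in>Y. amalg_class A B C i j (u @ v)),
      one = amalg_class A B C i j []\<rparr>"

text \<open>The group \<open>(D \<times> C) *\<^sub>C B\<close>, with \<open>C\<close> identified with \<open>{1} \<times> C\<close> on the left and
  with the given subgroup of \<open>B\<close> on the right.\<close>

definition direct_amalgam ::
    "('d, 'm) monoid_scheme \<Rightarrow> ('b, 'n) monoid_scheme \<Rightarrow> 'b set \<Rightarrow>
     ('d \<times> 'b + 'b) list set monoid" where
  "direct_amalgam D B C =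
     amalgamated_product (D \<times>\<times> B\<lparr>carrier := C\<rparr>) B (B\<lparr>carrier := C\<rparr>) (\<lambda>c. (\<one>\<^bsub>D\<^esub>, c)) (\<lambda>c. c)"


subsection \<open>The construction is the pushout of groups\<close>

locale amalgam = A: group A + B: group B + C: group C
  for A :: "('a, 'm) monoid_scheme" and B :: "('b, 'n) monoid_scheme"
    and C :: "('c, 'k) monoid_scheme" +
  fixes i :: "'c \<Rightarrow> 'a" and j :: "'c \<Rightarrow> 'b"
  assumes i_hom: "i \<in> hom C A" and j_hom: "j \<in> hom C B"
begin

abbreviation "cls \<equiv> amalg_class A B C i j"
abbreviation "P \<equiv> amalgamated_product A B C i j"

lemma amalg_eq_words:
  "amalg_eq A B C i j u v \<Longrightarrow> u \<in> amalg_words A B \<and> v \<in> amalg_words A B"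
  by (induction rule: amalg_eq.induct)
     (use i_hom j_hom in \<open>auto simp: amalg_words_def hom_def\<close>)

lemma cls_eqI: "amalg_eq A B C i j u v \<Longrightarrow> cls u = cls v"
  unfolding amalg_class_def
  by (rule Collect_cong) (rule iffI, erule amalg_eq.trans[OF amalg_eq.sym], assumption,
      erule amalg_eq.trans)

lemma cls_eq_iff:
  assumes "v \<in> amalg_words A B"
  shows "cls u = cls v \<longleftrightarrow> amalg_eq A B C i j u v"
proof
  assume "cls u = cls v"
  moreover have "v \<in> cls v"
    using assms unfolding amalg_class_def mem_Collect_eq by (rule amalg_eq.refl)
  ultimately have "v \<in> cls u" by (simp only:)
  then show "amalg_eq A B C i j u v"
    unfolding amalg_class_def mem_Collect_eq .
qed (rule cls_eqI)

lemma carrier_P: "carrier P = cls ` amalg_words A B"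
  and one_P: "\<one>\<^bsub>P\<^esub> = cls []"
  by (simp_all add: amalgamated_product_def)

lemma mult_P:
  assumes "u \<in> amalg_words A B" "v \<in> amalg_words A B"
  shows "cls u \<otimes>\<^bsub>P\<^esub> cls v = cls (u @ v)"
proof -
  have "cls (u' @ v') = cls (u @ v)" if "u' \<in> cls u" "v' \<in> cls v" for u' v'
    using that unfolding amalg_class_def[of _ _ _ _ _ u] amalg_class_def[of _ _ _ _ _ v] mem_Collect_eq
    by (intro cls_eqI amalg_eq.sym[OF amalg_eq.append])
  moreover have "u \<in> cls u" "v \<in> cls v"
    using assms by (simp_all add: amalg_class_def amalg_eq.refl)
  ultimately have "(\<Union>u'\<in>cls u. \<Union>v'\<in>cls v. cls (u' @ v')) = cls (u @ v)"
    by blast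
  then show ?thesis
    by (simp add: amalgamated_product_def)
qed

lemma words_append [simp]:
  "u @ v \<in> amalg_words A B \<longleftrightarrow> u \<in> amalg_words A B \<and> v \<in> amalg_words A B"
  and words_Nil [simp]: "[] \<in> amalg_words A B"
  and words_Inl [simp]: "Inl x # w \<in> amalg_words A B \<longleftrightarrow> x \<in> carrier A \<and> w \<in> amalg_words A B"
  and words_Inr [simp]: "Inr y # w \<in> amalg_words A B \<longleftrightarrow> y \<in> carrier B \<and> w \<in> amalg_words A B"
  by (auto simp: amalg_words_def)

definition inv_letter :: "'a + 'b \<Rightarrow> 'a + 'b" where
  "inv_letter = map_sum (m_inv A) (m_inv B)"

lemma inv_letter_eq:
  assumes "x \<in> carrier A <+> carrier B"
  shows "amalg_eq A B C i j [inv_letter x, x] []"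
  using assms
proof
  fix a assume a: "x = Inl a" "a \<in> carrier A"
  have "amalg_eq A B C i j [Inl (inv\<^bsub>A\<^esub> a), Inl a] [Inl (inv\<^bsub>A\<^esub> a \<otimes>\<^bsub>A\<^esub> a)]"
    using a by (intro amalg_eq.mult_left) auto
  then show ?thesis
    using a amalg_eq.trans[OF _ amalg_eq.one_left] by (simp add: inv_letter_def)
next
  fix b assume b: "x = Inr b" "b \<in> carrier B"
  have "amalg_eq A B C i j [Inr (inv\<^bsub>B\<^esub> b), Inr b] [Inr (inv\<^bsub>B\<^esub> b \<otimes>\<^bsub>B\<^esub> b)]"
    using b by (intro amalg_eq.mult_right) auto
  then show ?thesis
    using b amalg_eq.trans[OF _ amalg_eq.one_right] by (simp add: inv_letter_def)
qed

lemma left_inverse_word: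
  assumes "w \<in> amalg_words A B"
  shows "\<exists>v \<in> amalg_words A B. amalg_eq A B C i j (v @ w) []"
  using assms
proof (induction w)
  case Nil
  then show ?case by (auto intro!: bexI[of _ "[]"] amalg_eq.refl)
next
  case (Cons x w)
  then have xw: "x \<in> carrier A <+> carrier B" "w \<in> amalg_words A B"
    by (auto simp: amalg_words_def)
  then obtain v where v: "v \<in> amalg_words A B" "amalg_eq A B C i j (v @ w) []"
    using Cons.IH by blast
  have "amalg_eq A B C i j (v @ ([inv_letter x, x] @ w)) (v @ ([] @ w))"
    using v xw by (intro amalg_eq.append amalg_eq.refl inv_letter_eq) auto
  then have "amalg_eq A B C i j ((v @ [inv_letter x]) @ x # w) []"
    using amalg_eq.trans[OF _ v(2)] by simp
  then show ?case
    using amalg_eq_words words_append by blast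
qed

lemma group_P: "group P"
proof (rule groupI)
  show "\<exists>y\<in>carrier P. y \<otimes>\<^bsub>P\<^esub> x = \<one>\<^bsub>P\<^esub>" if "x \<in> carrier P" for x
  proof -
    obtain w where w: "w \<in> amalg_words A B" "x = cls w"
      using \<open>x \<in> carrier P\<close> by (auto simp: carrier_P)
    obtain v where "v \<in> amalg_words A B" "amalg_eq A B C i j (v @ w) []"
      using left_inverse_word[OF w(1)] by blast
    then show ?thesis
      using w by (auto simp: carrier_P one_P mult_P intro!: bexI[of _ "cls v"] cls_eqI)
  qed
qed (auto simp: carrier_P one_P mult_P)

definition inA :: "'a \<Rightarrow> ('a + 'b) list set" where "inA x = cls [Inl x]"
definition inB :: "'b \<Rightarrow> ('a + 'b) list set" where "inB y = cls [Inr y]"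

lemma inA_hom: "inA \<in> hom A P"
  by (auto simp: hom_def inA_def carrier_P mult_P intro!: cls_eqI amalg_eq.sym[OF amalg_eq.mult_left])

lemma inB_hom: "inB \<in> hom B P"
  by (auto simp: hom_def inB_def carrier_P mult_P intro!: cls_eqI amalg_eq.sym[OF amalg_eq.mult_right])

lemma in_glue: "c \<in> carrier C \<Longrightarrow> inA (i c) = inB (j c)"
  unfolding inA_def inB_def by (intro cls_eqI amalg_eq.glue)

lemma universal_property:
  fixes K :: "('g, 'l) monoid_scheme"
  assumes K: "group K" and f: "f \<in> hom A K" and g: "g \<in> hom B K"
    and fg: "\<And>c. c \<in> carrier C \<Longrightarrow> f (i c) = g (j c)"
  shows "\<exists>h \<in> hom P K. (\<forall>x \<in> carrier A. h (inA x) = f x) \<and> (\<forall>y \<in> carrier B. h (inB y) = g y)"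
    and "\<And>h h'. \<lbrakk>h \<in> hom P K; \<forall>x \<in> carrier A. h (inA x) = f x; \<forall>y \<in> carrier B. h (inB y) = g y;
           h' \<in> hom P K; \<forall>x \<in> carrier A. h' (inA x) = f x; \<forall>y \<in> carrier B. h' (inB y) = g y\<rbrakk>
         \<Longrightarrow> \<forall>p \<in> carrier P. h p = h' p"
proof -
  interpret K: group K by fact
  interpret f: group_hom A K f
    using f by unfold_locales
  interpret g: group_hom B K g
    using g by unfold_locales
  define ev where "ev = (\<lambda>w. foldr (\<lambda>x k. case_sum f g x \<otimes>\<^bsub>K\<^esub> k) w \<one>\<^bsub>K\<^esub>)"
  have ev_simps: "ev [] = \<one>\<^bsub>K\<^esub>" "ev (x # w) = case_sum f g x \<otimes>\<^bsub>K\<^esub> ev w" for x w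
    by (simp_all add: ev_def)
  have letter: "case_sum f g x \<in> carrier K" if "x \<in> carrier A <+> carrier B" for x
    using that by auto
  have ev_closed: "ev w \<in> carrier K" if "w \<in> amalg_words A B" for w
    using that letter by (induction w) (auto simp: ev_simps amalg_words_def)
  have ev_append: "ev (u @ v) = ev u \<otimes>\<^bsub>K\<^esub> ev v"
    if "u \<in> amalg_words A B" "v \<in> amalg_words A B" for u v
    using that(1)
  proof (induction u)
    case (Cons x u)
    then have xu: "x \<in> carrier A <+> carrier B" "u \<in> amalg_words A B"
      by (auto simp: amalg_words_def)
    then show ?case
      using Cons.IH ev_closed[OF xu(2)] ev_closed[OF that(2)] letter[OF xu(1)]
      by (simp add: ev_simps K.m_assoc)
  qed (use ev_closed[OF that(2)] in \<open>simp add: ev_simps\<close>)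
  have ev_eq: "ev u = ev v" if "amalg_eq A B C i j u v" for u v
    using that
  proof (induction rule: amalg_eq.induct)
    case (append u u' v v')
    then show ?case
      using amalg_eq_words[OF append.hyps(1)] amalg_eq_words[OF append.hyps(2)]
      by (simp add: ev_append)
  next
    case (glue c)
    then show ?case
      using fg i_hom j_hom by (simp add: ev_simps)
  qed (auto simp: ev_simps)
  define h where "h = (\<lambda>X. ev (SOME w. w \<in> X))"
  have h_cls: "h (cls w) = ev w" if "w \<in> amalg_words A B" for w
  proof -
    have "w \<in> cls w"
      using that by (simp add: amalg_class_def amalg_eq.refl)
    then have "(SOME w'. w' \<in> cls w) \<in> cls w"
      by (rule someI)
    then show ?thesis
      using ev_eq by (force simp: h_def amalg_class_def)
  qed
  have "h \<in> hom P K"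
    by (auto simp: hom_def carrier_P mult_P h_cls ev_closed ev_append)
  moreover have "h (inA x) = f x" if "x \<in> carrier A" for x
    using that by (simp add: inA_def h_cls ev_simps)
  moreover have "h (inB y) = g y" if "y \<in> carrier B" for y
    using that by (simp add: inB_def h_cls ev_simps)
  ultimately show "\<exists>h \<in> hom P K. (\<forall>x \<in> carrier A. h (inA x) = f x) \<and>
      (\<forall>y \<in> carrier B. h (inB y) = g y)"
    by blast
next
  fix h h'
  assume h: "h \<in> hom P K" "\<forall>x \<in> carrier A. h (inA x) = f x" "\<forall>y \<in> carrier B. h (inB y) = g y"
    and h': "h' \<in> hom P K" "\<forall>x \<in> carrier A. h' (inA x) = f x" "\<forall>y \<in> carrier B. h' (inB y) = g y"
  have "h (cls w) = h' (cls w)" if "w \<in> amalg_words A B" for w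
    using that
  proof (induction w)
    case Nil
    have "h \<one>\<^bsub>P\<^esub> = \<one>\<^bsub>K\<^esub>" "h' \<one>\<^bsub>P\<^esub> = \<one>\<^bsub>K\<^esub>"
      by (fact hom_one[OF h(1) group_P K] hom_one[OF h'(1) group_P K])+
    then show ?case by (simp add: one_P)
  next
    case (Cons x w)
    then have xw: "[x] \<in> amalg_words A B" "w \<in> amalg_words A B"
      by (auto simp: amalg_words_def)
    have split: "k (cls (x # w)) = k (cls [x]) \<otimes>\<^bsub>K\<^esub> k (cls w)" if "k \<in> hom P K" for k
      using hom_mult[OF that, of "cls [x]" "cls w"] xw mult_P[OF xw]
      by (auto simp: carrier_P)
    have "h (cls [x]) = h' (cls [x])"
      using xw h h' by (cases x) (auto simp: inA_def inB_def)
    then show ?case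
      using split[OF h(1)] split[OF h'(1)] Cons.IH[OF xw(2)] by simp
  qed
  then show "\<forall>p \<in> carrier P. h p = h' p"
    by (auto simp: carrier_P)
qed

end

lemma amalgam_direct:
  assumes "group D" "group B" "subgroup C B"
  shows "amalgam (D \<times>\<times> B\<lparr>carrier := C\<rparr>) B (B\<lparr>carrier := C\<rparr>) (\<lambda>c. (\<one>\<^bsub>D\<^esub>, c)) (\<lambda>c. c)"
proof -
  interpret D: group D by fact
  interpret C: subgroup C B by fact
  have "group (B\<lparr>carrier := C\<rparr>)"
    using assms by (simp add: subgroup.subgroup_is_group)
  then show ?thesis
    using assms unfolding amalgam_def amalgam_axioms_def
    by (auto simp: hom_def intro: DirProd_group)
qed

end

theory Submission
  imports Defs
begin

text \<open>
  Killing \<open>B\<close> maps \<open>G\<^sub>i\<close> onto \<open>D\<^sub>i\<close>, and the preimage \<open>K\<^sub>i\<close> of \<open>H\<^sub>i \<cong> H\<close> has index \<open>n\<close>. By Bass--Serre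
  theory \<open>K\<^sub>i\<close> is \<open>H \<times> C\<close> amalgamated along \<open>C\<close> with the \<open>n\<close> conjugates of \<open>B\<close> by a transversal
  of \<open>H\<^sub>i\<close>, because \<open>D\<^sub>i\<close> centralises \<open>C\<close>; this does not depend on \<open>D\<^sub>i\<close>. The isomorphism
  \<open>K\<^sub>1 \<cong> K\<^sub>2\<close> is obtained without normal forms. With transversals \<open>s\<close> of \<open>H\<^sub>1\<close> and \<open>t\<close> of \<open>H\<^sub>2\<close>
  indexed by \<open>k < n\<close>, and \<open>\<phi> : H\<^sub>1 \<cong> H\<^sub>2\<close>, the rules
  \<open>\<sigma>\<^sub>k(d) = \<phi>(s\<^sub>k d s\<^sub>l\<inverse>)\<close> for \<open>H\<^sub>1 s\<^sub>k d = H\<^sub>1 s\<^sub>l\<close>, \<open>\<sigma>\<^sub>k(c) = c\<close> and \<open>\<sigma>\<^sub>k(b) = t\<^sub>k b t\<^sub>k\<inverse>\<close> extend to a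
  cocycle \<open>G\<^sub>1 \<rightarrow> G\<^sub>2\<close> over the action of \<open>G\<^sub>1\<close> on the cosets, by the universal property. If \<open>\<tau>\<close> is the
  cocycle \<open>G\<^sub>2 \<rightarrow> G\<^sub>1\<close> obtained by exchanging the roles, then \<open>\<tau>\<^sub>0(\<sigma>\<^sub>k(g)) = s\<^sub>k g s\<^sub>l\<inverse>\<close> with \<open>l = k \<cdot> g\<close>, as
  one sees on generators; so \<open>\<sigma>\<^sub>0\<close> and \<open>\<tau>\<^sub>0\<close> restrict to mutually inverse isomorphisms between the
  stabilisers \<open>K\<^sub>1\<close> and \<open>K\<^sub>2\<close> of the base coset.
\<close>

text \<open>Cancellation in right-nested form: after rewriting with \<open>m_assoc\<close>, it makes
  products of Schreier elements telescope.\<close>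

lemma (in group) inv_mult_mult_cancel:
  "x \<in> carrier G \<Longrightarrow> y \<in> carrier G \<Longrightarrow> inv x \<otimes> (x \<otimes> y) = y"
  by (simp add: m_assoc[symmetric])

section \<open>Cocycles over a right action\<close>

text \<open>\<open>m\<close> is a right action of \<open>A\<close> on \<open>I\<close>, and the pair
  of \<open>m\<close> and \<open>f\<close> amounts to a homomorphism from \<open>A\<close> to the
  permutational wreath product of \<open>Q\<close> with the permutations of \<open>I\<close>.
  Keeping the two components apart avoids constructing that group.\<close>

locale group_cocycle = A: group A + Q: group Q
  for A :: "('a, 'm) monoid_scheme" and Q :: "('q, 'k) monoid_scheme" +
  fixes I :: "'i set" and m :: "'i \<Rightarrow> 'a \<Rightarrow> 'i" and f :: "'i \<Rightarrow> 'a \<Rightarrow> 'q"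
  assumes m_closed: "i \<in> I \<Longrightarrow> a \<in> carrier A \<Longrightarrow> m i a \<in> I"
    and f_closed: "i \<in> I \<Longrightarrow> a \<in> carrier A \<Longrightarrow> f i a \<in> carrier Q"
    and m_one: "i \<in> I \<Longrightarrow> m i \<one>\<^bsub>A\<^esub> = i"
    and m_mult: "i \<in> I \<Longrightarrow> a \<in> carrier A \<Longrightarrow> b \<in> carrier A \<Longrightarrow> m i (a \<otimes>\<^bsub>A\<^esub> b) = m (m i a) b"
    and f_mult: "i \<in> I \<Longrightarrow> a \<in> carrier A \<Longrightarrow> b \<in> carrier A \<Longrightarrow>
      f i (a \<otimes>\<^bsub>A\<^esub> b) = f i a \<otimes>\<^bsub>Q\<^esub> f (m i a) b"
begin

lemma f_one: "i \<in> I \<Longrightarrow> f i \<one>\<^bsub>A\<^esub> = \<one>\<^bsub>Q\<^esub>"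
  using f_mult[of i "\<one>\<^bsub>A\<^esub>" "\<one>\<^bsub>A\<^esub>"] m_one f_closed[of i "\<one>\<^bsub>A\<^esub>"]
  by (simp add: Q.l_cancel_one)

lemma m_inv:
  assumes "i \<in> I" "a \<in> carrier A"
  shows "m (m i a) (inv\<^bsub>A\<^esub> a) = i" "m (m i (inv\<^bsub>A\<^esub> a)) a = i"
  using m_mult[of i a "inv\<^bsub>A\<^esub> a"] m_mult[of i "inv\<^bsub>A\<^esub> a" a] m_one assms by simp_all

lemma f_inv:
  assumes "i \<in> I" "a \<in> carrier A"
  shows "f (m i a) (inv\<^bsub>A\<^esub> a) = inv\<^bsub>Q\<^esub> f i a"
proof -
  have "f i a \<otimes>\<^bsub>Q\<^esub> f (m i a) (inv\<^bsub>A\<^esub> a) = \<one>\<^bsub>Q\<^esub>"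
    using f_mult[of i a "inv\<^bsub>A\<^esub> a"] f_one assms by simp
  then show ?thesis
    using assms by (metis A.inv_closed Q.inv_equality Q.inv_inv f_closed m_closed Q.inv_closed)
qed

definition stab :: "'i \<Rightarrow> 'a set" where
  "stab i = {a \<in> carrier A. m i a = i}"

lemma stab_subgroup:
  assumes "i \<in> I"
  shows "subgroup (stab i) A"
proof (rule A.subgroupI)
  show "stab i \<noteq> {}"
    using assms m_one by (auto simp: stab_def)
  show "inv\<^bsub>A\<^esub> a \<in> stab i" if "a \<in> stab i" for a
    using that m_inv(1)[OF assms, of a] by (auto simp: stab_def)
qed (use assms m_mult in \<open>auto simp: stab_def\<close>)

lemma stab_coset_iff:
  assumes "i \<in> I" "a \<in> carrier A" "b \<in> carrier A"
  shows "stab i #>\<^bsub>A\<^esub> a = stab i #>\<^bsub>A\<^esub> b \<longleftrightarrow> m i a = m i b"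
proof -
  have eq: "m i (a \<otimes>\<^bsub>A\<^esub> inv\<^bsub>A\<^esub> b) = m (m i a) (inv\<^bsub>A\<^esub> b)"
    using assms by (simp add: m_mult)
  have "stab i #>\<^bsub>A\<^esub> a = stab i #>\<^bsub>A\<^esub> b \<longleftrightarrow> a \<otimes>\<^bsub>A\<^esub> inv\<^bsub>A\<^esub> b \<in> stab i"
    using assms stab_subgroup[OF assms(1)]
    by (metis A.coset_join1 A.coset_join2 A.coset_mult_inv1 A.coset_mult_inv2 A.inv_closed A.m_closed
        subgroup.subset)
  also have "\<dots> \<longleftrightarrow> m i a = m i b"
    using assms eq m_inv(1)[of i b] m_inv(2)[of "m i a" b] m_closed[of i a]
    by (auto simp: stab_def)
  finally show ?thesis .
qed

text \<open>Orbit-stabiliser: the coset of \<open>a\<close> is determined by the point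
  \<open>m i a\<close>, and by transitivity every point of \<open>I\<close> arises.\<close>

lemma stab_has_index:
  assumes "finite I" "i \<in> I" and trans: "\<And>k. k \<in> I \<Longrightarrow> \<exists>a \<in> carrier A. m i a = k"
  shows "has_index A (stab i) (card I)"
proof -
  obtain u where u: "\<And>k. k \<in> I \<Longrightarrow> u k \<in> carrier A \<and> m i (u k) = k"
    using trans by metis
  have "bij_betw (\<lambda>k. stab i #>\<^bsub>A\<^esub> u k) I (rcosets\<^bsub>A\<^esub> stab i)"
  proof (rule bij_betwI')
    show "(stab i #>\<^bsub>A\<^esub> u k = stab i #>\<^bsub>A\<^esub> u l) = (k = l)" if "k \<in> I" "l \<in> I" for k l
      using stab_coset_iff[OF assms(2)] u that by auto
    show "stab i #>\<^bsub>A\<^esub> u k \<in> rcosets\<^bsub>A\<^esub> stab i" if "k \<in> I" for k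
      using u that by (auto simp: RCOSETS_def)
    show "\<exists>k \<in> I. K = stab i #>\<^bsub>A\<^esub> u k" if K: "K \<in> rcosets\<^bsub>A\<^esub> stab i" for K
    proof -
      obtain a where a: "a \<in> carrier A" "K = stab i #>\<^bsub>A\<^esub> a"
        using K by (auto simp: RCOSETS_def)
      have "m i a \<in> I"
        using a assms m_closed by simp
      then show ?thesis
        using a u stab_coset_iff[OF assms(2)] by blast
    qed
  qed
  then show ?thesis
    using assms stab_subgroup bij_betw_finite bij_betw_same_card
    unfolding has_index_def by metis
qed

text \<open>Schreier's lemma: if \<open>u\<close> is a transversal, the elements \<open>u k \<cdot> a \<cdot> (u (m k a))\<inverse>\<close>, with \<open>a\<close>
  running over generators, generate the stabiliser.\<close>

lemma stab_finitely_generated: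
  assumes "finite I" "i \<in> I" and trans: "\<And>k. k \<in> I \<Longrightarrow> \<exists>a \<in> carrier A. m i a = k"
    and fg: "finitely_generated A"
  shows "finitely_generated (A\<lparr>carrier := stab i\<rparr>)"
proof -
  obtain S where S: "finite S" "S \<subseteq> carrier A" "generate A S = carrier A"
    using fg by (auto simp: finitely_generated_def)
  obtain u0 where u0: "\<And>k. k \<in> I \<Longrightarrow> u0 k \<in> carrier A \<and> m i (u0 k) = k"
    using trans by metis
  \<comment> \<open>The transversal is normalised at the base point, so that
    \<open>w i a = a\<close> for every \<open>a\<close> in the stabiliser; hence the stabiliser
    itself lies in the subgroup generated by \<open>W\<close>.\<close>
  define u where "u = u0(i := \<one>\<^bsub>A\<^esub>)"
  have u: "u k \<in> carrier A" "m i (u k) = k" if "k \<in> I" for k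
    using u0[OF that] assms(2) m_one by (auto simp: u_def)
  define w where "w k a = u k \<otimes>\<^bsub>A\<^esub> a \<otimes>\<^bsub>A\<^esub> inv\<^bsub>A\<^esub> u (m k a)" for k a
  define W where "W = (\<lambda>(k, a). w k a) ` (I \<times> S)"
  have w_stab: "w k a \<in> stab i" if "k \<in> I" "a \<in> carrier A" for k a
    using that u assms(2) m_closed[of k a] m_mult[of i "u k" a] m_inv(1)[of i "u (m k a)"]
    by (simp add: w_def stab_def m_mult m_closed)
  have W: "W \<subseteq> stab i"
    using w_stab S(2) by (auto simp: W_def)
  then have WA: "W \<subseteq> carrier A"
    by (auto simp: stab_def)
  have L: "subgroup (generate A W) A"
    by (rule A.generate_is_subgroup[OF WA])
  \<comment> \<open>The index \<open>k\<close> must vary in the induction, because the second factor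
    of a product is read at \<open>m k a\<close>.\<close>
  have "w k a \<in> generate A W" if "a \<in> generate A S" "k \<in> I" for a k
    using that
  proof (induction arbitrary: k rule: generate.induct)
    case one
    then show ?case
      using u m_one by (simp add: w_def generate.one)
  next
    case (incl a)
    then show ?case
      by (intro generate.incl) (auto simp: W_def)
  next
    case (inv a)
    have a: "a \<in> carrier A"
      using inv S(2) by auto
    define l where "l = m k (inv\<^bsub>A\<^esub> a)"
    have l: "l \<in> I" "m l a = k"
      using inv a m_closed m_inv(2) by (auto simp: l_def)
    have "w k (inv\<^bsub>A\<^esub> a) = inv\<^bsub>A\<^esub> (w l a)"
      using a l u inv by (simp add: w_def l_def[symmetric] A.inv_mult_group A.m_assoc)
    moreover have "w l a \<in> generate A W"
      using l inv by (intro generate.incl) (auto simp: W_def)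
    ultimately show ?case
      using subgroup.m_inv_closed[OF L] by simp
  next
    case (eng a b)
    have ab: "a \<in> carrier A" "b \<in> carrier A"
      using eng.hyps S(3) by auto
    have c: "m k a \<in> I" "m (m k a) b \<in> I"
      using ab eng.prems m_closed by auto
    have "w k (a \<otimes>\<^bsub>A\<^esub> b) = w k a \<otimes>\<^bsub>A\<^esub> w (m k a) b"
      using ab c u eng.prems m_mult[OF eng.prems ab]
      by (simp add: w_def A.m_assoc A.inv_mult_mult_cancel)
    then show ?case
      using eng.IH c eng.prems subgroup.m_closed[OF L] by simp
  qed
  note w_generated = this
  have "a \<in> generate A W" if "a \<in> stab i" for a
  proof -
    have "a \<in> carrier A" "m i a = i"
      using that by (auto simp: stab_def)
    then have "w i a = a"
      by (simp add: w_def u_def)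
    then show ?thesis
      using w_generated[of a i] S(3) assms(2) \<open>a \<in> carrier A\<close> by simp
  qed
  moreover have "generate A W \<subseteq> stab i"
    using A.generate_subgroup_incl[OF W stab_subgroup[OF assms(2)]] .
  ultimately have "generate (A\<lparr>carrier := stab i\<rparr>) W = stab i"
    using A.generate_consistent[OF W stab_subgroup[OF assms(2)]] by blast
  moreover have "finite W"
    using assms(1) S(1) by (simp add: W_def)
  ultimately show ?thesis
    using W unfolding finitely_generated_def by auto
qed

end

section \<open>Amalgamated products\<close>

context amalgam
begin

lemma carrier_P_induct [consumes 1, case_names one inA inB mult]:
  assumes "p \<in> carrier P" "R \<one>\<^bsub>P\<^esub>" "\<And>a. a \<in> carrier A \<Longrightarrow> R (inA a)"
    "\<And>b. b \<in> carrier B \<Longrightarrow> R (inB b)"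
    "\<And>p q. p \<in> carrier P \<Longrightarrow> q \<in> carrier P \<Longrightarrow> R p \<Longrightarrow> R q \<Longrightarrow> R (p \<otimes>\<^bsub>P\<^esub> q)"
  shows "R p"
proof -
  have "R (cls w)" if "w \<in> amalg_words A B" for w
    using that
  proof (induction w)
    case Nil
    then show ?case using assms(2) by (simp add: one_P)
  next
    case (Cons x w)
    then have xw: "[x] \<in> amalg_words A B" "w \<in> amalg_words A B"
      by (auto simp: amalg_words_def)
    have "R (cls [x])"
      using xw assms(3,4) by (cases x) (auto simp: inA_def inB_def)
    then have "R (cls [x] \<otimes>\<^bsub>P\<^esub> cls w)"
      using xw Cons.IH assms(5) by (simp add: carrier_P)
    then show ?case
      using mult_P[OF xw] by simp
  qed
  then show ?thesis
    using assms(1) by (auto simp: carrier_P)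
qed

text \<open>The pushout property for homomorphisms to a wreath product, carried out on words:
  reading a word letter by letter moves the index and multiplies up the values, and both results
  respect every defining relation of the amalgam.\<close>

lemma universal_cocycle:
  fixes Q :: "('q, 'l) monoid_scheme" and I :: "'i set"
  assumes mA: "group_cocycle A Q I mA fA" and mB: "group_cocycle B Q I mB fB"
    and agree: "\<And>k c. k \<in> I \<Longrightarrow> c \<in> carrier C \<Longrightarrow> mA k (i c) = mB k (j c) \<and> fA k (i c) = fB k (j c)"
  obtains m f where "group_cocycle P Q I m f"
    "\<And>k a. k \<in> I \<Longrightarrow> a \<in> carrier A \<Longrightarrow> m k (inA a) = mA k a \<and> f k (inA a) = fA k a"
    "\<And>k b. k \<in> I \<Longrightarrow> b \<in> carrier B \<Longrightarrow> m k (inB b) = mB k b \<and> f k (inB b) = fB k b"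
proof -
  interpret MA: group_cocycle A Q I mA fA by fact
  interpret MB: group_cocycle B Q I mB fB by fact
  define ml where "ml k = case_sum (mA k) (mB k)" for k
  define fl where "fl k = case_sum (fA k) (fB k)" for k
  \<comment> \<open>The recursion returns functions of \<open>k\<close>, since each letter changes
    the index at which the rest of the word is read.\<close>
  define mw where "mw = rec_list (\<lambda>k. k) (\<lambda>x w r k. r (ml k x))"
  define fw where "fw = rec_list (\<lambda>k. \<one>\<^bsub>Q\<^esub>) (\<lambda>x w r k. fl k x \<otimes>\<^bsub>Q\<^esub> r (ml k x))"
  have mw: "mw [] k = k" "mw (x # w) k = mw w (ml k x)" for k x w
    by (simp_all add: mw_def)
  have fw: "fw [] k = \<one>\<^bsub>Q\<^esub>" "fw (x # w) k = fl k x \<otimes>\<^bsub>Q\<^esub> fw w (ml k x)" for k x w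
    by (simp_all add: fw_def)
  have letter: "ml k x \<in> I" "fl k x \<in> carrier Q" if "k \<in> I" "x \<in> carrier A <+> carrier B" for k x
    using that MA.m_closed MB.m_closed MA.f_closed MB.f_closed by (auto simp: ml_def fl_def)
  have closed: "mw w k \<in> I \<and> fw w k \<in> carrier Q" if "w \<in> amalg_words A B" "k \<in> I" for w k
    using that
    by (induction w arbitrary: k) (auto simp: mw fw amalg_words_def letter simp del: Plus_def)
  have app: "mw (u @ v) k = mw v (mw u k) \<and> fw (u @ v) k = fw u k \<otimes>\<^bsub>Q\<^esub> fw v (mw u k)"
    if "u \<in> amalg_words A B" "v \<in> amalg_words A B" "k \<in> I" for u v k
    using that
  proof (induction u arbitrary: k)
    case (Cons x u)
    then have xu: "x \<in> carrier A <+> carrier B" "u \<in> amalg_words A B"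
      by (auto simp: amalg_words_def)
    have k: "ml k x \<in> I" "fl k x \<in> carrier Q"
      using letter Cons.prems xu by auto
    have "fw u (ml k x) \<in> carrier Q" "fw v (mw u (ml k x)) \<in> carrier Q"
      using closed k xu Cons.prems by auto
    then show ?case
      using Cons.IH[OF xu(2) Cons.prems(2) k(1)] k by (simp add: mw fw MA.Q.m_assoc)
  qed (simp add: mw fw closed)
  have eq: "mw u k = mw v k \<and> fw u k = fw v k" if "amalg_eq A B C i j u v" "k \<in> I" for u v k
    using that
  proof (induction arbitrary: k rule: amalg_eq.induct)
    case (append u u' v v')
    then show ?case
      using amalg_eq_words[OF append.hyps(1)] amalg_eq_words[OF append.hyps(2)]
      by (simp add: app closed)
  next
    case (glue c)
    then show ?case
      using agree by (simp add: mw fw ml_def fl_def)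
  qed (auto simp: mw fw ml_def fl_def MA.m_one MB.m_one MA.f_one MB.f_one MA.m_mult MB.m_mult
      MA.f_mult MB.f_mult MA.m_closed MB.m_closed MA.f_closed MB.f_closed)
  \<comment> \<open>By \<open>eq\<close> the result is the same for every representative of a class,
    so an arbitrary one is chosen.\<close>
  define m where "m k X = mw (SOME w. w \<in> X) k" for k X
  define f where "f k X = fw (SOME w. w \<in> X) k" for k X
  have cls: "m k (cls w) = mw w k" "f k (cls w) = fw w k" if "w \<in> amalg_words A B" "k \<in> I" for w k
  proof -
    have "w \<in> cls w"
      using that by (simp add: amalg_class_def amalg_eq.refl)
    then have "(SOME w'. w' \<in> cls w) \<in> cls w"
      by (rule someI)
    then have "amalg_eq A B C i j w (SOME w'. w' \<in> cls w)"
      by (simp add: amalg_class_def)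
    from eq[OF this that(2)] show "m k (cls w) = mw w k" "f k (cls w) = fw w k"
      by (simp_all add: m_def f_def)
  qed
  show thesis
  proof
    show "group_cocycle P Q I m f"
      unfolding group_cocycle_def group_cocycle_axioms_def
      using group_P MA.Q.is_group
      by (auto simp: carrier_P one_P mult_P cls closed app mw)
  qed (auto simp: inA_def inB_def cls mw fw ml_def fl_def MA.f_closed MB.f_closed)
qed

end

section \<open>The amalgam of a direct product with a group along the common factor\<close>

locale direct_amalgam_groups = D: group D + B: group B + C: subgroup C B
  for D :: "('d, 'm) monoid_scheme" and B :: "('b, 'n) monoid_scheme" and C :: "'b set"
begin

sublocale amalgam "D \<times>\<times> B\<lparr>carrier := C\<rparr>" B "B\<lparr>carrier := C\<rparr>" "\<lambda>c. (\<one>\<^bsub>D\<^esub>, c)" "\<lambda>c. c"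
  by (intro amalgam_direct D.is_group B.is_group C.subgroup_axioms)

sublocale P: group P
  by (rule group_P)

lemma P_eq: "P = direct_amalgam D B C"
  by (simp add: direct_amalgam_def)

definition inD :: "'d \<Rightarrow> ('d \<times> 'b + 'b) list set" where
  "inD d = inA (d, \<one>\<^bsub>B\<^esub>)"

lemma inB_closed: "b \<in> carrier B \<Longrightarrow> inB b \<in> carrier P"
  using inB_hom by (auto simp: hom_def)

lemma inB_mult: "b \<in> carrier B \<Longrightarrow> b' \<in> carrier B \<Longrightarrow> inB (b \<otimes>\<^bsub>B\<^esub> b') = inB b \<otimes>\<^bsub>P\<^esub> inB b'"
  using inB_hom by (auto simp: hom_def)

lemma inB_one: "inB \<one>\<^bsub>B\<^esub> = \<one>\<^bsub>P\<^esub>"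
  using hom_one[OF inB_hom B.is_group group_P] .

lemma inD_closed: "d \<in> carrier D \<Longrightarrow> inD d \<in> carrier P"
  using inA_hom by (auto simp: hom_def inD_def)

lemma inD_hom: "inD \<in> hom D P"
proof (rule homI)
  fix d d' assume d: "d \<in> carrier D" "d' \<in> carrier D"
  then have "inA ((d, \<one>\<^bsub>B\<^esub>) \<otimes>\<^bsub>D \<times>\<times> B\<lparr>carrier := C\<rparr>\<^esub> (d', \<one>\<^bsub>B\<^esub>)) = inD d \<otimes>\<^bsub>P\<^esub> inD d'"
    unfolding inD_def by (intro hom_mult[OF inA_hom]) auto
  then show "inD (d \<otimes>\<^bsub>D\<^esub> d') = inD d \<otimes>\<^bsub>P\<^esub> inD d'"
    by (simp add: inD_def)
qed (rule inD_closed)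

lemma inD_mult: "d \<in> carrier D \<Longrightarrow> d' \<in> carrier D \<Longrightarrow> inD (d \<otimes>\<^bsub>D\<^esub> d') = inD d \<otimes>\<^bsub>P\<^esub> inD d'"
  using inD_hom by (auto simp: hom_def)

lemma inD_one: "inD \<one>\<^bsub>D\<^esub> = \<one>\<^bsub>P\<^esub>"
  using hom_one[OF inD_hom D.is_group group_P] .

lemma inD_inv: "d \<in> carrier D \<Longrightarrow> inD (inv\<^bsub>D\<^esub> d) = inv\<^bsub>P\<^esub> (inD d)"
  using inD_hom D.is_group group_P
  by (metis group_hom.hom_inv group_hom.intro group_hom_axioms.intro)

text \<open>Gluing identifies the second coordinate \<open>c\<close> with \<open>inB c\<close>, and
  the two factors of a direct product commute. This is how the images of \<open>D\<close> and
  \<open>C\<close> come to commute in \<open>P\<close>.\<close>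

lemma inA_eq:
  assumes "d \<in> carrier D" "c \<in> C"
  shows "inA (d, c) = inD d \<otimes>\<^bsub>P\<^esub> inB c" "inA (d, c) = inB c \<otimes>\<^bsub>P\<^esub> inD d"
proof -
  have c: "c \<in> carrier B"
    using assms by auto
  have *: "inB c = inA (\<one>\<^bsub>D\<^esub>, c)"
    using in_glue[of c] assms by simp
  have "inA ((d, \<one>\<^bsub>B\<^esub>) \<otimes>\<^bsub>D \<times>\<times> B\<lparr>carrier := C\<rparr>\<^esub> (\<one>\<^bsub>D\<^esub>, c)) = inD d \<otimes>\<^bsub>P\<^esub> inB c"
    unfolding inD_def * using assms by (intro hom_mult[OF inA_hom]) auto
  then show "inA (d, c) = inD d \<otimes>\<^bsub>P\<^esub> inB c"
    using assms c by simp
  have "inA ((\<one>\<^bsub>D\<^esub>, c) \<otimes>\<^bsub>D \<times>\<times> B\<lparr>carrier := C\<rparr>\<^esub> (d, \<one>\<^bsub>B\<^esub>)) = inB c \<otimes>\<^bsub>P\<^esub> inD d"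
    unfolding inD_def * using assms by (intro hom_mult[OF inA_hom]) auto
  then show "inA (d, c) = inB c \<otimes>\<^bsub>P\<^esub> inD d"
    using assms c by simp
qed

lemma inD_inB_commute: "d \<in> carrier D \<Longrightarrow> c \<in> C \<Longrightarrow> inB c \<otimes>\<^bsub>P\<^esub> inD d = inD d \<otimes>\<^bsub>P\<^esub> inB c"
  using inA_eq by metis

text \<open>The \<open>C\<close>-coordinates are absorbed by \<open>B\<close>, so identities between
  cocycles need checking only on the images of \<open>D\<close> and \<open>B\<close>.\<close>

lemma induct_inD_inB [consumes 1, case_names one inD inB mult]:
  assumes "p \<in> carrier P" "R \<one>\<^bsub>P\<^esub>" "\<And>d. d \<in> carrier D \<Longrightarrow> R (inD d)"
    "\<And>b. b \<in> carrier B \<Longrightarrow> R (inB b)"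
    "\<And>p q. p \<in> carrier P \<Longrightarrow> q \<in> carrier P \<Longrightarrow> R p \<Longrightarrow> R q \<Longrightarrow> R (p \<otimes>\<^bsub>P\<^esub> q)"
  shows "R p"
  using assms(1)
proof (induction rule: carrier_P_induct)
  case (inA a)
  then obtain d c where dc: "a = (d, c)" "d \<in> carrier D" "c \<in> C" "c \<in> carrier B"
    by auto
  then have "R (inD d \<otimes>\<^bsub>P\<^esub> inB c)"
    using assms inD_closed inB_closed by blast
  then show ?case
    using dc inA_eq by simp
qed (use assms in auto)

lemma P_finitely_generated:
  assumes "finitely_generated D" "finitely_generated B"
  shows "finitely_generated P"
proof -
  obtain S where S: "finite S" "S \<subseteq> carrier D" "generate D S = carrier D"
    using assms(1) by (auto simp: finitely_generated_def)
  obtain T where T: "finite T" "T \<subseteq> carrier B" "generate B T = carrier B"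
    using assms(2) by (auto simp: finitely_generated_def)
  define X where "X = inD ` S \<union> inB ` T"
  have X: "X \<subseteq> carrier P"
    using S T inD_closed inB_closed by (auto simp: X_def)
  have "group_hom D P inD" "group_hom B P inB"
    using inD_hom inB_hom by unfold_locales
  then have "inD ` carrier D = generate P (inD ` S)" "inB ` carrier B = generate P (inB ` T)"
    using group_hom.generate_img S T by metis+
  then have sub: "inD ` carrier D \<subseteq> generate P X" "inB ` carrier B \<subseteq> generate P X"
    using P.mono_generate[of _ X] by (auto simp: X_def)
  have "p \<in> generate P X" if "p \<in> carrier P" for p
    using that
  proof (induction rule: induct_inD_inB)
    case (mult p q)
    then show ?case by (intro generate.eng)
  qed (use sub generate.one in auto)
  then show ?thesis
    using X S T P.generate_incl[OF X] unfolding finitely_generated_def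
    by (intro exI[of _ X]) (auto simp: X_def)
qed

end


section \<open>Transversals and the transfer cocycle\<close>

text \<open>Right coset representatives, with \<open>H\<close> itself represented by the identity at
  index 0. Numbering them by naturals below \<open>n\<close> gives the transversals in two different
  groups the same index set.\<close>

locale based_transversal = D: group D + H: subgroup H D
  for D :: "('d, 'm) monoid_scheme" and H :: "'d set" +
  fixes n :: nat and t :: "nat \<Rightarrow> 'd"
  assumes n_pos: "0 < n"
    and t_closed: "i < n \<Longrightarrow> t i \<in> carrier D"
    and t_0: "t 0 = \<one>\<^bsub>D\<^esub>"
    and t_ex1: "d \<in> carrier D \<Longrightarrow> \<exists>!i. i < n \<and> d \<otimes>\<^bsub>D\<^esub> inv\<^bsub>D\<^esub> t i \<in> H"
begin

definition idx :: "'d \<Rightarrow> nat" where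
  "idx d = (THE i. i < n \<and> d \<otimes>\<^bsub>D\<^esub> inv\<^bsub>D\<^esub> t i \<in> H)"

definition mv :: "nat \<Rightarrow> 'd \<Rightarrow> nat" where
  "mv i d = idx (t i \<otimes>\<^bsub>D\<^esub> d)"

text \<open>The Schreier cocycle: \<open>co i d\<close> is the element of \<open>H\<close> that
  takes \<open>t (mv i d)\<close> to \<open>t i\<close> times \<open>d\<close> by left
  multiplication, while \<open>mv\<close> is the right action on the cosets of
  \<open>H\<close>.\<close>

definition co :: "nat \<Rightarrow> 'd \<Rightarrow> 'd" where
  "co i d = t i \<otimes>\<^bsub>D\<^esub> d \<otimes>\<^bsub>D\<^esub> inv\<^bsub>D\<^esub> t (mv i d)"

lemma idx:
  assumes "d \<in> carrier D"
  shows "idx d < n" "d \<otimes>\<^bsub>D\<^esub> inv\<^bsub>D\<^esub> t (idx d) \<in> H"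
  using theI'[OF t_ex1[OF assms]] by (simp_all add: idx_def)

lemma idx_eqI:
  assumes "d \<in> carrier D" "i < n" "d \<otimes>\<^bsub>D\<^esub> inv\<^bsub>D\<^esub> t i \<in> H"
  shows "idx d = i"
  unfolding idx_def using assms by (intro the1_equality t_ex1) simp_all

lemma idx_t: "i < n \<Longrightarrow> idx (t i) = i"
  by (rule idx_eqI) (auto simp: t_closed)

lemma mv_less: "i < n \<Longrightarrow> d \<in> carrier D \<Longrightarrow> mv i d < n"
  by (simp add: mv_def idx t_closed)

lemma co_in_H: "i < n \<Longrightarrow> d \<in> carrier D \<Longrightarrow> co i d \<in> H"
  by (simp add: mv_def co_def idx t_closed)

lemma mv_mult:
  assumes "i < n" "a \<in> carrier D" "b \<in> carrier D"
  shows "mv i (a \<otimes>\<^bsub>D\<^esub> b) = mv (mv i a) b"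
proof -
  define j where "j = mv i a"
  define k where "k = mv j b"
  have j: "j < n" "t j \<in> carrier D"
    using mv_less t_closed assms by (auto simp: j_def)
  have k: "k < n" "t k \<in> carrier D"
    using mv_less t_closed assms j by (auto simp: k_def)
  \<comment> \<open>The product of the two Schreier elements lies in \<open>H\<close> and
    telescopes, which exhibits \<open>k\<close> as the index of the coset of \<open>t i\<close>
    times \<open>a\<close> times \<open>b\<close>.\<close>
  have "co i a \<otimes>\<^bsub>D\<^esub> co j b \<in> H"
    using co_in_H assms j by auto
  also have "co i a = t i \<otimes>\<^bsub>D\<^esub> a \<otimes>\<^bsub>D\<^esub> inv\<^bsub>D\<^esub> t j"
    by (simp add: co_def j_def)
  also have "co j b = t j \<otimes>\<^bsub>D\<^esub> b \<otimes>\<^bsub>D\<^esub> inv\<^bsub>D\<^esub> t k"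
    by (simp add: co_def k_def)
  also have "t i \<otimes>\<^bsub>D\<^esub> a \<otimes>\<^bsub>D\<^esub> inv\<^bsub>D\<^esub> t j \<otimes>\<^bsub>D\<^esub> (t j \<otimes>\<^bsub>D\<^esub> b \<otimes>\<^bsub>D\<^esub> inv\<^bsub>D\<^esub> t k) = t i \<otimes>\<^bsub>D\<^esub> (a \<otimes>\<^bsub>D\<^esub> b) \<otimes>\<^bsub>D\<^esub> inv\<^bsub>D\<^esub> t k"
    using assms(2,3) t_closed[OF assms(1)] j(2) k(2) by (simp add: D.m_assoc D.inv_mult_mult_cancel)
  finally have "idx (t i \<otimes>\<^bsub>D\<^esub> (a \<otimes>\<^bsub>D\<^esub> b)) = k"
    using assms t_closed[OF assms(1)] k(1) by (intro idx_eqI) simp_all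
  then show ?thesis
    by (simp add: mv_def[of i "a \<otimes>\<^bsub>D\<^esub> b"] j_def k_def)
qed

lemma cocycle: "group_cocycle D D {..<n} mv co"
proof
  show "mv i a \<in> {..<n}" if "i \<in> {..<n}" "a \<in> carrier D" for i a
    using that mv_less by simp
  show "co i a \<in> carrier D" if "i \<in> {..<n}" "a \<in> carrier D" for i a
    using that co_in_H H.subset by blast
  show "mv i \<one>\<^bsub>D\<^esub> = i" if "i \<in> {..<n}" for i
    using that by (simp add: mv_def t_closed idx_t)
  show "mv i (a \<otimes>\<^bsub>D\<^esub> b) = mv (mv i a) b" if "i \<in> {..<n}" "a \<in> carrier D" "b \<in> carrier D" for i a b
    using that mv_mult by simp
  show "co i (a \<otimes>\<^bsub>D\<^esub> b) = co i a \<otimes>\<^bsub>D\<^esub> co (mv i a) b"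
    if "i \<in> {..<n}" "a \<in> carrier D" "b \<in> carrier D" for i a b
    using that mv_less[of i a] mv_less[of "mv i a" b] t_closed[of i] t_closed[of "mv i a"]
      t_closed[of "mv (mv i a) b"]
    by (simp add: co_def mv_mult D.m_assoc D.inv_mult_mult_cancel)
qed

sublocale group_cocycle D D "{..<n}" mv co
  by (rule cocycle)

lemma mv_0_t: "i < n \<Longrightarrow> mv 0 (t i) = i"
  by (simp add: mv_def t_0 t_closed idx_t)

lemma co_0_t: "i < n \<Longrightarrow> co 0 (t i) = \<one>\<^bsub>D\<^esub>"
  by (simp add: co_def mv_0_t t_0 t_closed)

lemma mv_0_H: "h \<in> H \<Longrightarrow> mv 0 h = 0"
  using n_pos by (simp add: mv_def t_0 idx_eqI)

lemma co_0_H: "h \<in> H \<Longrightarrow> co 0 h = h"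
  by (simp add: co_def mv_0_H t_0)

end

lemma has_index_based_transversal:
  assumes "group D" "has_index D H n"
  obtains t where "based_transversal D H n t"
proof -
  interpret D: group D by fact
  have H: "subgroup H D" and fin: "finite (rcosets\<^bsub>D\<^esub> H)" and card: "card (rcosets\<^bsub>D\<^esub> H) = n"
    using assms(2) by (auto simp: has_index_def)
  interpret H: subgroup H D by fact
  have HH: "H \<in> rcosets\<^bsub>D\<^esub> H"
    by (rule H.subgroup_in_rcosets[OF D.is_group])
  then have n: "0 < n"
    using fin card card_gt_0_iff by blast
  \<comment> \<open>The cosets other than \<open>H\<close> are enumerated by the nonzero indices
    first; extending by \<open>H\<close> at 0 then permits the identity as representative
    there.\<close>
  have "card (rcosets\<^bsub>D\<^esub> H - {H}) = card ({..<n} - {0})"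
    using HH fin card n by simp
  then obtain h0 where h0: "bij_betw h0 ({..<n} - {0}) (rcosets\<^bsub>D\<^esub> H - {H})"
    using fin finite_same_card_bij[of "{..<n} - {0}" "rcosets\<^bsub>D\<^esub> H - {H}"] by auto
  have "\<exists>h. bij_betw h {..<n} (rcosets\<^bsub>D\<^esub> H) \<and> h 0 = H"
  proof -
    have "bij_betw (h0(0 := H)) ({..<n} - {0}) (rcosets\<^bsub>D\<^esub> H - {H})"
      using h0 by (rule bij_betw_cong[THEN iffD1, rotated]) auto
    then have "bij_betw (h0(0 := H)) (({..<n} - {0}) \<union> {0}) ((rcosets\<^bsub>D\<^esub> H - {H}) \<union> {H})"
      using notIn_Un_bij_betw[of 0 "{..<n} - {0}" "h0(0 := H)" "rcosets\<^bsub>D\<^esub> H - {H}"] by simp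
    moreover have "({..<n} - {0}) \<union> {0} = {..<n}" "(rcosets\<^bsub>D\<^esub> H - {H}) \<union> {H} = rcosets\<^bsub>D\<^esub> H"
      using n HH by auto
    ultimately have "bij_betw (h0(0 := H)) {..<n} (rcosets\<^bsub>D\<^esub> H)"
      by simp
    then show ?thesis by (intro exI[of _ "h0(0 := H)"]) simp
  qed
  then obtain h where h: "bij_betw h {..<n} (rcosets\<^bsub>D\<^esub> H)" "h 0 = H"
    by blast
  have "\<exists>x \<in> carrier D. h i = H #>\<^bsub>D\<^esub> x" if "i < n" for i
    using bij_betwE[OF h(1)] that by (auto simp: RCOSETS_def)
  then obtain t0 where t0: "\<And>i. i < n \<Longrightarrow> t0 i \<in> carrier D \<and> h i = H #>\<^bsub>D\<^esub> t0 i"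
    by metis
  define t where "t = t0(0 := \<one>\<^bsub>D\<^esub>)"
  have t: "t i \<in> carrier D" "h i = H #>\<^bsub>D\<^esub> t i" if "i < n" for i
    using t0[OF that] h(2) H.subset by (auto simp: t_def)
  have mem: "d \<otimes>\<^bsub>D\<^esub> inv\<^bsub>D\<^esub> t i \<in> H \<longleftrightarrow> h i = H #>\<^bsub>D\<^esub> d" if "d \<in> carrier D" "i < n" for d i
    using t[OF that(2)] that(1) H H.subset
    by (metis D.coset_join1 D.coset_join2 D.coset_mult_inv1 D.coset_mult_inv2 D.inv_closed D.m_closed)
  show thesis
  proof (rule that, unfold_locales)
    show "\<exists>!i. i < n \<and> d \<otimes>\<^bsub>D\<^esub> inv\<^bsub>D\<^esub> t i \<in> H" if "d \<in> carrier D" for d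
    proof -
      have "H #>\<^bsub>D\<^esub> d \<in> rcosets\<^bsub>D\<^esub> H"
        using that by (auto simp: RCOSETS_def)
      then obtain i where "i < n" "h i = H #>\<^bsub>D\<^esub> d"
        using bij_betw_imp_surj_on[OF h(1)] by (metis imageE lessThan_iff)
      moreover have "k = i" if "k < n" "h k = h i" for k
        using that \<open>i < n\<close> h(1) by (auto simp: bij_betw_def inj_on_def)
      ultimately show ?thesis
        using mem[OF that] by metis
    qed
  qed (use n t in \<open>auto simp: t_def\<close>)
qed

section \<open>The transfer cocycle from one amalgam to the other\<close>

locale amalgam_transfer =
  X: direct_amalgam_groups D1 B C + Y: direct_amalgam_groups D2 B C +
  S: based_transversal D1 H1 n s + T: based_transversal D2 H2 n t
  for D1 :: "('d1, 'm1) monoid_scheme" and D2 :: "('d2, 'm2) monoid_scheme"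
    and B :: "('b, 'm) monoid_scheme" and C :: "'b set" and H1 H2 n s t +
  fixes \<phi> :: "'d1 \<Rightarrow> 'd2"
  assumes \<phi>_closed: "h \<in> H1 \<Longrightarrow> \<phi> h \<in> H2"
    and \<phi>_mult: "h \<in> H1 \<Longrightarrow> h' \<in> H1 \<Longrightarrow> \<phi> (h \<otimes>\<^bsub>D1\<^esub> h') = \<phi> h \<otimes>\<^bsub>D2\<^esub> \<phi> h'"
begin

lemma \<phi>_one: "\<phi> \<one>\<^bsub>D1\<^esub> = \<one>\<^bsub>D2\<^esub>"
  using \<phi>_mult[of "\<one>\<^bsub>D1\<^esub>" "\<one>\<^bsub>D1\<^esub>"] \<phi>_closed[of "\<one>\<^bsub>D1\<^esub>"] T.H.subset
  by (auto simp: Y.D.l_cancel_one)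

text \<open>The values on \<open>B\<close> are conjugates by \<open>t k\<close> because \<sigma> at
  index 0 is to send the conjugate of \<open>b\<close> by \<open>s k\<close> to the conjugate of
  \<open>b\<close> by \<open>t k\<close>. Elements of \<open>B\<close> fix all indices, as they die
  in \<open>D1\<close>.\<close>

definition transfer :: "(nat \<Rightarrow> ('d1 \<times> 'b + 'b) list set \<Rightarrow> nat) \<Rightarrow>
    (nat \<Rightarrow> ('d1 \<times> 'b + 'b) list set \<Rightarrow> ('d2 \<times> 'b + 'b) list set) \<Rightarrow> bool" where
  "transfer \<mu> \<sigma> \<longleftrightarrow> group_cocycle X.P Y.P {..<n} \<mu> \<sigma> \<and>
    (\<forall>k<n. \<forall>d \<in> carrier D1. \<mu> k (X.inD d) = S.mv k d \<and> \<sigma> k (X.inD d) = Y.inD (\<phi> (S.co k d))) \<and>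
    (\<forall>k<n. \<forall>b \<in> carrier B. \<mu> k (X.inB b) = k \<and>
      \<sigma> k (X.inB b) = Y.inD (t k) \<otimes>\<^bsub>Y.P\<^esub> Y.inB b \<otimes>\<^bsub>Y.P\<^esub> inv\<^bsub>Y.P\<^esub> Y.inD (t k))"

lemma transfer_exists: "\<exists>\<mu> \<sigma>. transfer \<mu> \<sigma>"
proof -
  let ?A = "D1 \<times>\<times> B\<lparr>carrier := C\<rparr>"
  define mA where "mA k = (\<lambda>(d, c :: 'b). S.mv k d)" for k
  define fA where "fA k = (\<lambda>(d, c). Y.inD (\<phi> (S.co k d)) \<otimes>\<^bsub>Y.P\<^esub> Y.inB c)" for k
  define fB where "fB k b = Y.inD (t k) \<otimes>\<^bsub>Y.P\<^esub> Y.inB b \<otimes>\<^bsub>Y.P\<^esub> inv\<^bsub>Y.P\<^esub> Y.inD (t k)" for k b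
  have \<phi>co: "\<phi> (S.co k d) \<in> carrier D2" "Y.inD (\<phi> (S.co k d)) \<in> carrier Y.P"
    if "k < n" "d \<in> carrier D1" for k d
    using that S.co_in_H \<phi>_closed T.H.subset Y.inD_closed by auto
  have tk: "Y.inD (t k) \<in> carrier Y.P" if "k < n" for k
    using that T.t_closed Y.inD_closed by auto
  have cA: "group_cocycle ?A Y.P {..<n} mA fA"
  proof (unfold_locales, goal_cases)
    case (5 k a b)
    obtain d c d' c' where ab: "a = (d, c)" "b = (d', c')" "d \<in> carrier D1" "d' \<in> carrier D1"
        "c \<in> C" "c' \<in> C" "c \<in> carrier B" "c' \<in> carrier B"
      using 5 by auto
    have k: "k < n" "S.mv k d < n"
      using 5 ab S.mv_less by auto
    define x where "x = Y.inD (\<phi> (S.co k d))"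
    define y where "y = Y.inD (\<phi> (S.co (S.mv k d) d'))"
    have xy: "x \<in> carrier Y.P" "y \<in> carrier Y.P" "Y.inB c \<in> carrier Y.P" "Y.inB c' \<in> carrier Y.P"
      using \<phi>co k ab Y.inB_closed by (auto simp: x_def y_def)
    have 1: "Y.inD (\<phi> (S.co k (d \<otimes>\<^bsub>D1\<^esub> d'))) = x \<otimes>\<^bsub>Y.P\<^esub> y"
      using k ab S.co_in_H \<phi>_mult \<phi>co by (simp add: S.f_mult x_def y_def Y.inD_mult)
    \<comment> \<open>The values of the cocycle on \<open>D1\<close> come from \<open>D2\<close>,
      which commutes with \<open>C\<close>; so the two coordinates multiply independently.\<close>
    have 2: "Y.inB c \<otimes>\<^bsub>Y.P\<^esub> y = y \<otimes>\<^bsub>Y.P\<^esub> Y.inB c"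
      using Y.inD_inB_commute \<phi>co ab k by (simp add: y_def)
    have "x \<otimes>\<^bsub>Y.P\<^esub> y \<otimes>\<^bsub>Y.P\<^esub> (Y.inB c \<otimes>\<^bsub>Y.P\<^esub> Y.inB c') =
        x \<otimes>\<^bsub>Y.P\<^esub> (y \<otimes>\<^bsub>Y.P\<^esub> Y.inB c) \<otimes>\<^bsub>Y.P\<^esub> Y.inB c'"
      using xy by (simp add: Y.P.m_assoc)
    also have "\<dots> = (x \<otimes>\<^bsub>Y.P\<^esub> Y.inB c) \<otimes>\<^bsub>Y.P\<^esub> (y \<otimes>\<^bsub>Y.P\<^esub> Y.inB c')"
      using xy unfolding 2[symmetric] by (simp add: Y.P.m_assoc)
    finally show ?case
      using ab k by (simp add: fA_def mA_def 1 Y.inB_mult x_def[symmetric] y_def[symmetric])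
  qed (auto simp: mA_def fA_def S.m_one S.mv_mult S.mv_less \<phi>co Y.inB_closed)
  \<comment> \<open>With the trivial action on indices, the cocycle identity says that each
    \<open>fB k\<close> is a homomorphism, and it is a conjugation.\<close>
  have cB: "group_cocycle B Y.P {..<n} (\<lambda>k b. k) fB"
  proof (unfold_locales, goal_cases)
    case (5 k a b)
    then have "Y.inD (t k) \<in> carrier Y.P" "Y.inB a \<in> carrier Y.P" "Y.inB b \<in> carrier Y.P"
      using tk Y.inB_closed by auto
    then show ?case
      using 5 by (simp add: fB_def Y.inB_mult Y.P.m_assoc Y.P.inv_mult_mult_cancel)
  qed (auto simp: fB_def tk Y.inB_closed)
  obtain \<mu> \<sigma> where ms: "group_cocycle X.P Y.P {..<n} \<mu> \<sigma>"
    "\<And>k a. k \<in> {..<n} \<Longrightarrow> a \<in> carrier ?A \<Longrightarrow> \<mu> k (X.inA a) = mA k a \<and> \<sigma> k (X.inA a) = fA k a"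
    "\<And>k b. k \<in> {..<n} \<Longrightarrow> b \<in> carrier B \<Longrightarrow> \<mu> k (X.inB b) = k \<and> \<sigma> k (X.inB b) = fB k b"
  proof (rule X.universal_cocycle[OF cA cB])
    fix k c assume k: "k \<in> {..<n}" and "c \<in> carrier (B\<lparr>carrier := C\<rparr>)"
    then have c: "c \<in> C" "c \<in> carrier B" by auto
    \<comment> \<open>Conjugation by \<open>t k\<close> is trivial on \<open>C\<close>; hence the
      cocycles on the two factors agree over the amalgamated subgroup.\<close>
    have "Y.inD (t k) \<otimes>\<^bsub>Y.P\<^esub> Y.inB c = Y.inB c \<otimes>\<^bsub>Y.P\<^esub> Y.inD (t k)"
      using Y.inD_inB_commute c k T.t_closed by auto
    then have "fB k c = Y.inB c"
      using tk k c Y.inB_closed by (simp add: fB_def Y.P.m_assoc)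
    then show "mA k (\<one>\<^bsub>D1\<^esub>, c) = k \<and> fA k (\<one>\<^bsub>D1\<^esub>, c) = fB k c"
      using k c S.m_one S.f_one \<phi>_one Y.inD_one Y.inB_closed by (simp add: mA_def fA_def)
  qed blast
  have "transfer \<mu> \<sigma>"
    unfolding transfer_def
  proof (intro conjI allI ballI impI)
    fix k d assume kd: "k < n" "d \<in> carrier D1"
    show "\<mu> k (X.inD d) = S.mv k d" "\<sigma> k (X.inD d) = Y.inD (\<phi> (S.co k d))"
      using kd ms(2)[of k "(d, \<one>\<^bsub>B\<^esub>)"] \<phi>co
      by (simp_all add: X.inD_def mA_def fA_def Y.inB_one)
  qed (use ms in \<open>auto simp: fB_def\<close>)
  then show ?thesis by blast
qed

end

section \<open>Composing the transfers in both directions\<close>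

locale amalgam_transfer_pair = F: amalgam_transfer D1 D2 B C H1 H2 n s t \<phi> +
  R: amalgam_transfer D2 D1 B C H2 H1 n t s \<psi>
  for D1 :: "('d1, 'm1) monoid_scheme" and D2 :: "('d2, 'm2) monoid_scheme"
    and B :: "('b, 'm) monoid_scheme" and C :: "'b set" and H1 H2 n s t \<phi> \<psi> +
  assumes \<psi>_\<phi>: "h \<in> H1 \<Longrightarrow> \<psi> (\<phi> h) = h"
begin

text \<open>Both sides of the second equation satisfy the same product rule in \<open>g\<close>, so
  generators suffice. The first equation is carried along since it keeps the second transfer at
  index 0 while the factors of a product are evaluated; all \<open>k\<close> are needed because the
  first factor moves \<open>k\<close>.\<close>

lemma transfer_transfer:
  assumes F: "F.transfer \<mu> \<sigma>" and R: "R.transfer \<nu> \<tau>" and g: "g \<in> carrier F.X.P"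
  shows "\<forall>k<n. \<nu> 0 (\<sigma> k g) = 0 \<and> \<tau> 0 (\<sigma> k g) =
    F.X.inD (s k) \<otimes>\<^bsub>F.X.P\<^esub> g \<otimes>\<^bsub>F.X.P\<^esub> inv\<^bsub>F.X.P\<^esub> F.X.inD (s (\<mu> k g))"
proof -
  interpret M: group_cocycle F.X.P F.Y.P "{..<n}" \<mu> \<sigma>
    using F by (simp add: F.transfer_def)
  interpret N: group_cocycle F.Y.P F.X.P "{..<n}" \<nu> \<tau>
    using R by (simp add: R.transfer_def)
  have MD: "\<mu> k (F.X.inD d) = F.S.mv k d" "\<sigma> k (F.X.inD d) = F.Y.inD (\<phi> (F.S.co k d))"
    if "k < n" "d \<in> carrier D1" for k d
    using F that by (auto simp: F.transfer_def)
  have MB: "\<mu> k (F.X.inB b) = k" "\<sigma> k (F.X.inB b) =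
      F.Y.inD (t k) \<otimes>\<^bsub>F.Y.P\<^esub> F.Y.inB b \<otimes>\<^bsub>F.Y.P\<^esub> inv\<^bsub>F.Y.P\<^esub> F.Y.inD (t k)"
    if "k < n" "b \<in> carrier B" for k b
    using F that by (auto simp: F.transfer_def)
  have ND: "\<nu> k (F.Y.inD d) = F.T.mv k d" "\<tau> k (F.Y.inD d) = F.X.inD (\<psi> (F.T.co k d))"
    if "k < n" "d \<in> carrier D2" for k d
    using R that by (auto simp: R.transfer_def)
  have NB: "\<nu> k (F.Y.inB b) = k" "\<tau> k (F.Y.inB b) =
      F.X.inD (s k) \<otimes>\<^bsub>F.X.P\<^esub> F.X.inB b \<otimes>\<^bsub>F.X.P\<^esub> inv\<^bsub>F.X.P\<^esub> F.X.inD (s k)"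
    if "k < n" "b \<in> carrier B" for k b
    using R that by (auto simp: R.transfer_def)
  have n0: "0 < n"
    by (rule F.S.n_pos)
  have s: "F.X.inD (s k) \<in> carrier F.X.P" if "k < n" for k
    using that F.S.t_closed F.X.inD_closed by auto
  have t: "F.Y.inD (t k) \<in> carrier F.Y.P" if "k < n" for k
    using that F.T.t_closed F.Y.inD_closed by auto
  show ?thesis
    using g
  proof (induction rule: F.X.induct_inD_inB)
    case one
    then show ?case
      using n0 s by (simp add: M.f_one M.m_one N.f_one N.m_one)
  next
    case (inD d)
    show ?case
    proof (intro allI impI)
      fix k assume k: "k < n"
      define h where "h = F.S.co k d"
      have h: "h \<in> H1" "\<phi> h \<in> H2" "\<phi> h \<in> carrier D2"
        using F.S.co_in_H[OF k inD] F.\<phi>_closed F.T.H.subset by (auto simp: h_def)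
      have m: "F.S.mv k d < n" "s k \<in> carrier D1" "s (F.S.mv k d) \<in> carrier D1"
        using F.S.mv_less F.S.t_closed k inD by auto
      \<comment> \<open>On \<open>D1\<close> the right-hand side is the Schreier element
        \<open>h\<close>. The value \<phi> \<open>h\<close> lies in \<open>H2\<close>, so the second
        transfer fixes index 0 there and applies only \<psi>.\<close>
      have "F.X.inD h = F.X.inD (s k) \<otimes>\<^bsub>F.X.P\<^esub> F.X.inD d \<otimes>\<^bsub>F.X.P\<^esub> inv\<^bsub>F.X.P\<^esub> F.X.inD (s (F.S.mv k d))"
        using m inD by (simp add: h_def F.S.co_def F.X.inD_mult F.X.inD_inv)
      moreover have "\<nu> 0 (F.Y.inD (\<phi> h)) = 0" "\<tau> 0 (F.Y.inD (\<phi> h)) = F.X.inD h"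
        using ND[OF n0 h(3)] h F.T.mv_0_H F.T.co_0_H \<psi>_\<phi> by auto
      ultimately show "\<nu> 0 (\<sigma> k (F.X.inD d)) = 0 \<and> \<tau> 0 (\<sigma> k (F.X.inD d)) = F.X.inD (s k) \<otimes>\<^bsub>F.X.P\<^esub>
          F.X.inD d \<otimes>\<^bsub>F.X.P\<^esub> inv\<^bsub>F.X.P\<^esub> F.X.inD (s (\<mu> k (F.X.inD d)))"
        using MD[OF k inD] by (simp add: h_def)
    qed
  next
    case (inB b)
    show ?case
    proof (intro allI impI)
      fix k assume k: "k < n"
      \<comment> \<open>The element \<open>t k\<close> leads from index 0 to \<open>k\<close> with
        trivial value and its inverse leads back, so \<tau> at 0 of the conjugate of
        \<open>b\<close> by \<open>t k\<close> is \<tau> at \<open>k\<close> of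
        \<open>b\<close>.\<close>
      have t0: "\<nu> 0 (F.Y.inD (t k)) = k" "\<tau> 0 (F.Y.inD (t k)) = \<one>\<^bsub>F.X.P\<^esub>"
        using ND[OF n0 F.T.t_closed[OF k]] F.T.mv_0_t[OF k] F.T.co_0_t[OF k] R.\<phi>_one F.X.inD_one
        by auto
      have ti: "\<nu> k (inv\<^bsub>F.Y.P\<^esub> F.Y.inD (t k)) = 0" "\<tau> k (inv\<^bsub>F.Y.P\<^esub> F.Y.inD (t k)) = \<one>\<^bsub>F.X.P\<^esub>"
        using N.m_inv(1)[of 0 "F.Y.inD (t k)"] N.f_inv[of 0 "F.Y.inD (t k)"] t0 t[OF k] n0 by auto
      have "\<nu> 0 (\<sigma> k (F.X.inB b)) = 0 \<and> \<tau> 0 (\<sigma> k (F.X.inB b)) = \<tau> k (F.Y.inB b)"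
        using MB[OF k inB] t0 ti NB[OF k inB] t[OF k] n0 k F.Y.inB_closed[OF inB] N.f_closed[of k "F.Y.inB b"]
        by (simp add: N.m_mult N.f_mult)
      then show "\<nu> 0 (\<sigma> k (F.X.inB b)) = 0 \<and> \<tau> 0 (\<sigma> k (F.X.inB b)) = F.X.inD (s k) \<otimes>\<^bsub>F.X.P\<^esub>
          F.X.inB b \<otimes>\<^bsub>F.X.P\<^esub> inv\<^bsub>F.X.P\<^esub> F.X.inD (s (\<mu> k (F.X.inB b)))"
        using MB[OF k inB] NB[OF k inB] by simp
    qed
  next
    case (mult p q)
    show ?case
    proof (intro allI impI)
      fix k assume k: "k < n"
      have j: "\<mu> k p < n" "\<mu> (\<mu> k p) q < n"
        using M.m_closed k mult.hyps by auto
      have "\<sigma> k p \<in> carrier F.Y.P" "\<sigma> (\<mu> k p) q \<in> carrier F.Y.P"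
        using M.f_closed k j mult.hyps by auto
      then show "\<nu> 0 (\<sigma> k (p \<otimes>\<^bsub>F.X.P\<^esub> q)) = 0 \<and> \<tau> 0 (\<sigma> k (p \<otimes>\<^bsub>F.X.P\<^esub> q)) = F.X.inD (s k) \<otimes>\<^bsub>F.X.P\<^esub>
          (p \<otimes>\<^bsub>F.X.P\<^esub> q) \<otimes>\<^bsub>F.X.P\<^esub> inv\<^bsub>F.X.P\<^esub> F.X.inD (s (\<mu> k (p \<otimes>\<^bsub>F.X.P\<^esub> q)))"
        using k j mult n0 s
        by (simp add: M.m_mult M.f_mult N.m_mult N.f_mult F.X.P.m_assoc F.X.P.inv_mult_mult_cancel)
    qed
  qed
qed

text \<open>For \<open>k = 0\<close> and \<open>g\<close> in the stabiliser of 0, both conjugating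
  factors are \<open>s 0\<close>, the identity.\<close>

lemma transfer_stab:
  assumes F: "F.transfer \<mu> \<sigma>" and R: "R.transfer \<nu> \<tau>" and g: "g \<in> carrier F.X.P" "\<mu> 0 g = 0"
  shows "\<nu> 0 (\<sigma> 0 g) = 0" "\<tau> 0 (\<sigma> 0 g) = g"
  using transfer_transfer[OF assms(1-3)] F.S.n_pos F.S.t_0 F.X.inD_one g by auto

lemma transfer_transitive:
  assumes "F.transfer \<mu> \<sigma>" "k < n"
  shows "\<exists>g \<in> carrier F.X.P. \<mu> 0 g = k"
proof
  show "\<mu> 0 (F.X.inD (s k)) = k"
    using assms F.S.mv_0_t F.S.t_closed F.S.n_pos by (simp add: F.transfer_def)
qed (use assms F.S.t_closed F.X.inD_closed in auto)

end

theorem theorem1: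
  fixes B :: "('b, 'm) monoid_scheme" and C :: "'b set"
    and D1 :: "('d1, 'm1) monoid_scheme" and D2 :: "('d2, 'm2) monoid_scheme"
    and H :: "('h, 'k) monoid_scheme" and n :: nat
  assumes "group B" and "finitely_generated B"
    and "subgroup C B" and "finitely_generated (B\<lparr>carrier := C\<rparr>)"
    and "group D1" and "finitely_generated D1"
    and "group D2" and "finitely_generated D2"
    and "group_retract C B"
    and "common_subgroup_of_index H D1 D2 n"
  shows "have_common_subgroup_of_index (direct_amalgam D1 B C) (direct_amalgam D2 B C) n"
proof -
  obtain H1 H2 where H: "group H" "has_index D1 H1 n" "H \<cong> D1\<lparr>carrier := H1\<rparr>"
    "has_index D2 H2 n" "H \<cong> D2\<lparr>carrier := H2\<rparr>"
    using assms(10) by (auto simp: common_subgroup_of_index_def iso_to_subgroup_of_index_def)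
  have sub: "subgroup H1 D1" "subgroup H2 D2"
    using H by (auto simp: has_index_def)
  interpret H1: group "D1\<lparr>carrier := H1\<rparr>"
    using sub assms(5) by (simp add: subgroup.subgroup_is_group)
  have "D1\<lparr>carrier := H1\<rparr> \<cong> D2\<lparr>carrier := H2\<rparr>"
    using H group.iso_sym iso_trans by blast
  then obtain \<phi> where \<phi>: "\<phi> \<in> iso (D1\<lparr>carrier := H1\<rparr>) (D2\<lparr>carrier := H2\<rparr>)"
    by (auto simp: is_iso_def)
  define \<psi> where "\<psi> = inv_into H1 \<phi>"
  have \<psi>: "\<psi> \<in> iso (D2\<lparr>carrier := H2\<rparr>) (D1\<lparr>carrier := H1\<rparr>)"
    using H1.iso_set_sym[OF \<phi>] by (simp add: \<psi>_def)
  have bij: "bij_betw \<phi> H1 H2"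
    using \<phi> by (simp add: iso_def)
  obtain s where s: "based_transversal D1 H1 n s"
    using has_index_based_transversal[OF assms(5) H(2)] .
  obtain t where t: "based_transversal D2 H2 n t"
    using has_index_based_transversal[OF assms(7) H(4)] .
  have "direct_amalgam_groups D1 B C" "direct_amalgam_groups D2 B C"
    using assms by (auto simp: direct_amalgam_groups_def)
  then have tr: "amalgam_transfer D1 D2 B C H1 H2 n s t \<phi>" "amalgam_transfer D2 D1 B C H2 H1 n t s \<psi>"
    using s t \<phi> \<psi> unfolding amalgam_transfer_def amalgam_transfer_axioms_def
    by (auto simp: iso_def hom_def)
  interpret F: amalgam_transfer_pair D1 D2 B C H1 H2 n s t \<phi> \<psi>
    using tr bij unfolding amalgam_transfer_pair_def amalgam_transfer_pair_axioms_def
    by (auto simp: \<psi>_def bij_betw_inv_into_left)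
  \<comment> \<open>Exchanging the roles turns the one-sided inverse statement into its mirror
    image; together they give mutually inverse maps.\<close>
  interpret R: amalgam_transfer_pair D2 D1 B C H2 H1 n t s \<psi> \<phi>
    using tr bij unfolding amalgam_transfer_pair_def amalgam_transfer_pair_axioms_def
    by (auto simp: \<psi>_def bij_betw_inv_into_right)
  obtain \<mu> \<sigma> where M: "F.F.transfer \<mu> \<sigma>"
    using F.F.transfer_exists by blast
  obtain \<nu> \<tau> where N: "F.R.transfer \<nu> \<tau>"
    using F.R.transfer_exists by blast
  interpret M: group_cocycle F.F.X.P F.F.Y.P "{..<n}" \<mu> \<sigma>
    using M by (simp add: F.F.transfer_def)
  interpret N: group_cocycle F.F.Y.P F.F.X.P "{..<n}" \<nu> \<tau>
    using N by (simp add: F.R.transfer_def)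
  have n0: "0 \<in> {..<n}"
    using F.F.S.n_pos by simp
  have transM: "\<exists>g \<in> carrier F.F.X.P. \<mu> 0 g = k" if "k \<in> {..<n}" for k
    using F.transfer_transitive[OF M] that by simp
  have transN: "\<exists>g \<in> carrier F.F.Y.P. \<nu> 0 g = k" if "k \<in> {..<n}" for k
    using R.transfer_transitive[OF N] that by simp
  let ?K = "F.F.X.P\<lparr>carrier := M.stab 0\<rparr>" and ?L = "F.F.Y.P\<lparr>carrier := N.stab 0\<rparr>"
  \<comment> \<open>On the stabiliser of 0 the index stays at 0, so the cocycle identity becomes
    multiplicativity.\<close>
  have "\<sigma> 0 \<in> hom ?K ?L"
    using F.transfer_stab[OF M N] n0 M.f_mult M.f_closed
    by (auto simp: hom_def M.stab_def N.stab_def)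
  moreover have "bij_betw (\<sigma> 0) (M.stab 0) (N.stab 0)"
    by (rule bij_betw_byWitness[where f' = "\<tau> 0"])
      (use F.transfer_stab[OF M N] R.transfer_stab[OF N M] n0 M.f_closed N.f_closed in
        \<open>auto simp: M.stab_def N.stab_def\<close>)
  ultimately have KL: "?K \<cong> ?L"
    by (auto simp: is_iso_def iso_def)
  have index: "has_index F.F.X.P (M.stab 0) n" "has_index F.F.Y.P (N.stab 0) n"
    using M.stab_has_index[OF _ n0 transM] N.stab_has_index[OF _ n0 transN] by simp_all
  have "group ?K"
    using M.stab_subgroup[OF n0] F.F.X.group_P by (simp add: subgroup.subgroup_is_group)
  moreover have "finitely_generated ?K"
    using M.stab_finitely_generated[OF _ n0 transM] F.F.X.P_finitely_generated assms(2,6) by simp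
  ultimately have "common_subgroup_of_index ?K F.F.X.P F.F.Y.P n"
    using index KL iso_refl unfolding common_subgroup_of_index_def iso_to_subgroup_of_index_def
    by blast
  then show ?thesis
    using have_common_subgroup_of_indexI[OF F.F.X.group_P] by (simp add: F.F.X.P_eq F.F.Y.P_eq)
qed

end
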